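(* Let $a_n = \tan\left(\frac{1}{n+2}\right)$ for all integers $n\ge 0$. Then the terraced matrix $M=M(a)$ generated by the sequence $a=\{a_n\}_{n\ge 0}$ is a hyponormal operator on $\ell^2$.
   Context: $\ell^2$ denotes the Hilbert space of square-summable complex sequences indexed by the nonnegative integers. For a sequence $a=\{a_n\}_{n\ge 0}$ of complex numbers, the terraced matrix $M(a)$ generated by $a$ is the lower triangular infinite matrix with constant row segments, i.e. the matrix with entries $m_{nj}=a_n$ for $0\le j\le n$ and $m_{nj}=0$ for $j>n$ ($n,j\ge 0$); it acts on $\ell^2$ by matrix multiplication, $(Mf)_n = a_n\sum_{j=0}^n f_j$. A bounded linear operator $M$ on $\ell^2$ is hyponormal if $\langle (M^*M-MM^* )f,f\rangle\ge 0$ for all $f\in\ell^2$. Saying that a terraced matrix is a hyponormal operator on $\ell^2$ means that it acts as a bounded linear operator on $\ell^2$ and this operator is hyponormal. *)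

theory Defs
  imports "HOL-Analysis.Analysis"
begin

text \<open>
  The Hilbert space of square-summable complex sequences is modelled as a set of functions.
  Operators are functions on all sequences, of which only the restriction to this set matters.
\<close>

definition ell2 :: "(nat \<Rightarrow> complex) set" where
  "ell2 = {f. summable (\<lambda>n. (cmod (f n))\<^sup>2)}"

definition ell2_norm :: "(nat \<Rightarrow> complex) \<Rightarrow> real" where
  "ell2_norm f = sqrt (\<Sum>n. (cmod (f n))\<^sup>2)"

text \<open>Linear in the first argument and conjugate-linear in the second.\<close>

definition ell2_inner :: "(nat \<Rightarrow> complex) \<Rightarrow> (nat \<Rightarrow> complex) \<Rightarrow> complex" where
  "ell2_inner f g = (\<Sum>n. f n * cnj (g n))"

definition ell2_bounded_op :: "((nat \<Rightarrow> complex) \<Rightarrow> (nat \<Rightarrow> complex)) \<Rightarrow> bool" where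
  "ell2_bounded_op T \<longleftrightarrow>
     (\<forall>f\<in>ell2. T f \<in> ell2) \<and>
     (\<forall>f\<in>ell2. \<forall>g\<in>ell2. T (\<lambda>n. f n + g n) = (\<lambda>n. T f n + T g n)) \<and>
     (\<forall>c. \<forall>f\<in>ell2. T (\<lambda>n. c * f n) = (\<lambda>n. c * T f n)) \<and>
     (\<exists>C. \<forall>f\<in>ell2. ell2_norm (T f) \<le> C * ell2_norm f)"

definition ell2_adjoint_of ::
  "((nat \<Rightarrow> complex) \<Rightarrow> (nat \<Rightarrow> complex)) \<Rightarrow> ((nat \<Rightarrow> complex) \<Rightarrow> (nat \<Rightarrow> complex)) \<Rightarrow> bool" where
  "ell2_adjoint_of T S \<longleftrightarrow>
     ell2_bounded_op S \<and> (\<forall>f\<in>ell2. \<forall>g\<in>ell2. ell2_inner (T f) g = ell2_inner f (S g))"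

text \<open>
  Adjoints are unique on \<open>ell2\<close>, so the existential quantifier in the definition of
  hyponormality below does not choose among different operators.
\<close>

lemma ell2_adjoint_unique:
  assumes "ell2_adjoint_of T S" "ell2_adjoint_of T S'" "g \<in> ell2"
  shows "S g = S' g"
proof
  fix k
  define e :: "nat \<Rightarrow> complex" where "e = (\<lambda>n. if n = k then 1 else 0)"
  have "summable (\<lambda>n. (cmod (e n))\<^sup>2)"
    by (rule summable_finite[of "{k}"]) (auto simp: e_def)
  hence e: "e \<in> ell2"
    by (simp add: ell2_def)
  have pick: "ell2_inner e h = cnj (h k)" for h
  proof -
    have "(\<Sum>n. e n * cnj (h n)) = (\<Sum>n\<in>{k}. e n * cnj (h n))"
      by (rule suminf_finite) (auto simp: e_def)
    thus ?thesis
      by (simp add: ell2_inner_def e_def)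
  qed
  have "ell2_inner e (S g) = ell2_inner e (S' g)"
    using assms e unfolding ell2_adjoint_of_def by metis
  thus "S g k = S' g k"
    by (simp add: pick)
qed

text \<open>
  Membership in \<open>\<real>\<^sub>\<ge>\<^sub>0\<close>, a set of complex numbers here, says that the inner product is
  real and nonnegative.
\<close>

definition ell2_hyponormal :: "((nat \<Rightarrow> complex) \<Rightarrow> (nat \<Rightarrow> complex)) \<Rightarrow> bool" where
  "ell2_hyponormal T \<longleftrightarrow>
     ell2_bounded_op T \<and>
     (\<exists>S. ell2_adjoint_of T S \<and>
          (\<forall>f\<in>ell2. ell2_inner (\<lambda>n. S (T f) n - T (S f) n) f \<in> \<real>\<^sub>\<ge>\<^sub>0))"

definition terraced_matrix :: "(nat \<Rightarrow> complex) \<Rightarrow> nat \<Rightarrow> nat \<Rightarrow> complex" where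
  "terraced_matrix a n j = (if j \<le> n then a n else 0)"

definition matrix_op :: "(nat \<Rightarrow> nat \<Rightarrow> complex) \<Rightarrow> (nat \<Rightarrow> complex) \<Rightarrow> (nat \<Rightarrow> complex)" where
  "matrix_op m f n = (\<Sum>j. m n j * f j)"

lemma matrix_op_terraced: "matrix_op (terraced_matrix a) f n = a n * (\<Sum>j\<le>n. f j)"
proof -
  have "(\<Sum>j. terraced_matrix a n j * f j) = (\<Sum>j\<le>n. terraced_matrix a n j * f j)"
    by (rule suminf_finite) (auto simp: terraced_matrix_def)
  thus ?thesis
    by (simp add: matrix_op_def terraced_matrix_def sum_distrib_left)
qed

end

theory Submission
  imports Defs
begin

text \<open>
  The operator is hyponormal because the sequence \<open>b n = 1 / a n = cot (1 / (n + 2))\<close> is concave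
  with increments at least 1, and stays concave when it is extended to the left by the positive
  number \<open>cot 1\<close>.

  Write \<open>S n = f 0 + \<dots> + f n\<close>, \<open>g n = a n * S n\<close> for the image of \<open>f\<close> and
  \<open>T j = (\<Sum>n\<ge>j. a n * f n)\<close> for the image of \<open>f\<close> under the adjoint. Hyponormality is the
  inequality \<open>(\<Sum>j. \<bar>T j\<bar>\<^sup>2) \<le> (\<Sum>j. \<bar>g j\<bar>\<^sup>2)\<close>. Put \<open>D j = T (j + 1) + g j\<close>. Then
  \<open>D 0 = T 0\<close>, and
  \<open>D j - D (j + 1) = (a j - a (j + 1)) * S j = g j / c j\<close> with
  \<open>c j = b (j + 1) / (b (j + 1) - b j)\<close>. Expanding \<open>\<bar>T (j + 1)\<bar>\<^sup>2 = \<bar>D j - g j\<bar>\<^sup>2\<close> and eliminating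
  the mixed term with the help of \<open>\<bar>D (j + 1)\<bar>\<^sup>2 = \<bar>D j - g j / c j\<bar>\<^sup>2\<close> gives the identity
  \<open>(\<Sum>j\<le>N. \<bar>g j\<bar>\<^sup>2) - (\<Sum>j\<le>N+1. \<bar>T j\<bar>\<^sup>2)
     = (c 0 - 2) * \<bar>D 0\<bar>\<^sup>2 + (\<Sum>j=1..N. (c j - c (j - 1) - 1) * \<bar>D j\<bar>\<^sup>2)
       + (\<Sum>j\<le>N. \<bar>g j\<bar>\<^sup>2 / c j) - c N * \<bar>D (N + 1)\<bar>\<^sup>2\<close>.
  Concavity of \<open>b\<close> says precisely what is needed to make \<open>c j - c (j - 1) \<ge> 1\<close>, and the
  extension to the left makes \<open>c 0 \<ge> 2\<close>. The boundary term \<open>c N * \<bar>D (N + 1)\<bar>\<^sup>2\<close> is at most a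
  multiple of \<open>N\<close> times a term of a convergent series, hence small for infinitely many \<open>N\<close>,
  because the harmonic series diverges.

  The convergent series come from Hardy's inequality and its dual, which also show that the
  operator and its adjoint are bounded. The concavity of \<open>b\<close> is that of \<open>cot (1 / x)\<close>, whose
  derivative \<open>1 / (x * sin (1 / x))\<^sup>2\<close> is decreasing for \<open>x \<ge> 1\<close> and never below 1.
\<close>

section \<open>Hardy's inequality and its dual\<close>

text \<open>
  Hardy's inequality and its dual rest on the same two steps. If \<open>A\<close> denotes the transform of \<open>x\<close>, then
  \<open>A\<^sup>2 - 2 * A * x\<close> is bounded by a telescoping difference with favourable boundary terms, and
  \<open>A\<^sup>2 \<le> 2 * (A\<^sup>2 - 2 * A * x) + 4 * x\<^sup>2\<close> because the difference is the square of \<open>A - 2 * x\<close>.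
\<close>

lemma sum_squares_le_of_cross_terms:
  fixes A x :: "nat \<Rightarrow> real"
  assumes "(\<Sum>n<N. (A n)\<^sup>2 - 2 * A n * x n) \<le> 0"
  shows "(\<Sum>n<N. (A n)\<^sup>2) \<le> 4 * (\<Sum>n<N. (x n)\<^sup>2)"
proof -
  have "(A n)\<^sup>2 \<le> 2 * ((A n)\<^sup>2 - 2 * A n * x n) + 4 * (x n)\<^sup>2" for n
    using zero_le_power2[of "A n - 2 * x n"] by (simp add: power2_eq_square algebra_simps)
  hence "(\<Sum>n<N. (A n)\<^sup>2) \<le> (\<Sum>n<N. 2 * ((A n)\<^sup>2 - 2 * A n * x n) + 4 * (x n)\<^sup>2)"
    by (intro sum_mono)
  also have "\<dots> = 2 * (\<Sum>n<N. (A n)\<^sup>2 - 2 * A n * x n) + 4 * (\<Sum>n<N. (x n)\<^sup>2)"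
    by (simp only: sum.distrib sum_distrib_left)
  finally show ?thesis
    using assms by linarith
qed

lemma hardy_inequality:
  fixes x :: "nat \<Rightarrow> real"
  shows "(\<Sum>n<N. ((\<Sum>j\<le>n. x j) / real (Suc n))\<^sup>2) \<le> 4 * (\<Sum>n<N. (x n)\<^sup>2)"
proof (rule sum_squares_le_of_cross_terms)
  define s where "s n = (\<Sum>j<n. x j)" for n
  define A where "A n = s (Suc n) / real (Suc n)" for n
  \<comment> \<open>At \<open>N = 0\<close> the quotient is \<open>0 / 0 = 0\<close>.\<close>
  have "(\<Sum>n<N. (A n)\<^sup>2 - 2 * A n * x n) \<le> - ((s N)\<^sup>2 / real N)" for N
  proof (induction N)
    case 0
    show ?case by simp
  next
    case (Suc N)
    have "(A N)\<^sup>2 - 2 * A N * x N - (s N)\<^sup>2 / real N \<le> - ((s (Suc N))\<^sup>2 / real (Suc N))"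
    proof (cases "N = 0")
      case True
      thus ?thesis by (simp add: A_def s_def power2_eq_square)
    next
      case False
      define m where "m = real N"
      have m: "m > 0" "real (Suc N) = m + 1" using False by (auto simp: m_def)
      define p where "p = A N"
      have p: "s (Suc N) = (m + 1) * p" using m by (simp add: p_def A_def del: of_nat_Suc)
      have x: "x N = (m + 1) * p - s N" using p by (simp add: s_def)
      have q: "(s (Suc N))\<^sup>2 / real (Suc N) = (m + 1) * p\<^sup>2"
        using m unfolding p m(2) by (simp add: power2_eq_square)
      have "- ((s (Suc N))\<^sup>2 / real (Suc N)) - ((A N)\<^sup>2 - 2 * A N * x N - (s N)\<^sup>2 / real N)
          = (m * p - s N)\<^sup>2 / m"
        using m(1) unfolding q x p_def[symmetric] m_def[symmetric]
        by (simp add: field_simps power2_eq_square)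
      also have "\<dots> \<ge> 0" using m by simp
      finally show ?thesis by linarith
    qed
    thus ?case using Suc by simp
  qed
  from this[of N] have "(\<Sum>n<N. (A n)\<^sup>2 - 2 * A n * x n) \<le> 0"
    by (rule order_trans) simp
  thus "(\<Sum>n<N. ((\<Sum>j\<le>n. x j) / real (Suc n))\<^sup>2 - 2 * ((\<Sum>j\<le>n. x j) / real (Suc n)) * x n) \<le> 0"
    by (simp add: A_def s_def lessThan_Suc_atMost)
qed

lemma dual_hardy_inequality:
  fixes x :: "nat \<Rightarrow> real"
  shows "(\<Sum>j<N. (\<Sum>n=j..<N. x n / real (Suc n))\<^sup>2) \<le> 4 * (\<Sum>j<N. (x j)\<^sup>2)"
proof (rule sum_squares_le_of_cross_terms)
  define t where "t j = (\<Sum>n=j..<N. x n / real (Suc n))" for j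
  have "(\<Sum>j<m. (t j)\<^sup>2 - 2 * t j * x j) \<le> real m * (t m)\<^sup>2" if "m \<le> N" for m
    using that
  proof (induction m)
    case 0
    show ?case by simp
  next
    case (Suc m)
    have "t m = x m / real (Suc m) + t (Suc m)"
      using Suc.prems by (simp add: t_def sum.atLeast_Suc_lessThan)
    hence x: "x m = real (Suc m) * (t m - t (Suc m))"
      by (simp add: field_simps)
    have "real (Suc m) * (t (Suc m))\<^sup>2 - ((t m)\<^sup>2 - 2 * t m * x m + real m * (t m)\<^sup>2)
        = real (Suc m) * (t m - t (Suc m))\<^sup>2"
      unfolding x by (simp add: power2_eq_square algebra_simps)
    also have "\<dots> \<ge> 0" by simp
    finally show ?case using Suc by simp
  qed
  from this[of N] show "(\<Sum>j<N. (\<Sum>n=j..<N. x n / real (Suc n))\<^sup>2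
      - 2 * (\<Sum>n=j..<N. x n / real (Suc n)) * x j) \<le> 0"
    by (simp add: t_def)
qed

section \<open>Square-summable sequences\<close>

lemma summable_cmod_mult_ell2:
  assumes "f \<in> ell2" "g \<in> ell2"
  shows "summable (\<lambda>n. cmod (f n) * cmod (g n))"
proof (rule summable_comparison_test')
  show "summable (\<lambda>n. (cmod (f n))\<^sup>2 + (cmod (g n))\<^sup>2)"
    using assms by (auto simp: ell2_def intro: summable_add)
  show "norm (cmod (f n) * cmod (g n)) \<le> (cmod (f n))\<^sup>2 + (cmod (g n))\<^sup>2" for n
  proof -
    have "2 * (cmod (f n) * cmod (g n)) \<le> (cmod (f n))\<^sup>2 + (cmod (g n))\<^sup>2"
      using sum_squares_bound[of "cmod (f n)" "cmod (g n)"] by (simp add: mult.assoc)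
    moreover have "0 \<le> cmod (f n) * cmod (g n)" by simp
    ultimately have "cmod (f n) * cmod (g n) \<le> (cmod (f n))\<^sup>2 + (cmod (g n))\<^sup>2" by linarith
    thus ?thesis by simp
  qed
qed

lemma summable_ell2_inner:
  assumes "f \<in> ell2" "g \<in> ell2"
  shows "summable (\<lambda>n. f n * cnj (g n))"
  by (rule summable_norm_cancel) (simp add: norm_mult summable_cmod_mult_ell2 assms)

lemma cnj_ell2_inner:
  assumes "f \<in> ell2" "g \<in> ell2"
  shows "cnj (ell2_inner f g) = ell2_inner g f"
proof -
  have "(\<lambda>n. cnj (f n * cnj (g n))) sums cnj (ell2_inner f g)"
    unfolding ell2_inner_def sums_cnj using summable_ell2_inner[OF assms] by (rule summable_sums)
  thus ?thesis
    by (simp add: ell2_inner_def sums_iff mult.commute)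
qed

lemma ell2_norm_nonneg: "f \<in> ell2 \<Longrightarrow> 0 \<le> ell2_norm f"
  by (simp add: ell2_norm_def ell2_def suminf_nonneg)

lemma ell2_norm_squared: "f \<in> ell2 \<Longrightarrow> (ell2_norm f)\<^sup>2 = (\<Sum>n. (cmod (f n))\<^sup>2)"
  by (simp add: ell2_norm_def ell2_def suminf_nonneg)

lemma ell2_inner_self:
  assumes "f \<in> ell2"
  shows "ell2_inner f f = complex_of_real ((ell2_norm f)\<^sup>2)"
proof -
  have "ell2_inner f f = (\<Sum>n. complex_of_real ((cmod (f n))\<^sup>2))"
    unfolding ell2_inner_def complex_norm_square ..
  also have "\<dots> = complex_of_real (\<Sum>n. (cmod (f n))\<^sup>2)"
    using assms by (intro suminf_of_real[symmetric]) (simp add: ell2_def)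
  finally show ?thesis
    using assms by (simp add: ell2_norm_squared)
qed

lemma sum_cmod_squared_le_ell2_norm:
  "f \<in> ell2 \<Longrightarrow> (\<Sum>n<N. (cmod (f n))\<^sup>2) \<le> (ell2_norm f)\<^sup>2"
  by (simp add: ell2_norm_squared ell2_def sum_le_suminf)

lemma ell2_of_bounded_partial_sums:
  assumes "\<And>N. (\<Sum>n<N. (cmod (h n))\<^sup>2) \<le> B\<^sup>2" "0 \<le> B"
  shows "h \<in> ell2" "ell2_norm h \<le> B"
proof -
  show h: "h \<in> ell2"
    unfolding ell2_def mem_Collect_eq by (rule summableI_nonneg_bounded[OF _ assms(1)]) simp
  hence "(\<Sum>n. (cmod (h n))\<^sup>2) \<le> B\<^sup>2"
    by (intro suminf_le_const assms(1)) (simp add: ell2_def)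
  hence "(ell2_norm h)\<^sup>2 \<le> B\<^sup>2"
    using h by (simp add: ell2_norm_squared)
  thus "ell2_norm h \<le> B"
    using assms(2) power2_le_imp_le by blast
qed

text \<open>
  The identity \<open>\<langle>(S T - T S) f, f\<rangle> = \<parallel>T f\<parallel>\<^sup>2 - \<parallel>S f\<parallel>\<^sup>2\<close> turns hyponormality into a comparison of
  norms.
\<close>

lemma ell2_hyponormalI:
  assumes T: "ell2_bounded_op T" and S: "ell2_adjoint_of T S"
    and le: "\<And>f. f \<in> ell2 \<Longrightarrow> ell2_norm (S f) \<le> ell2_norm (T f)"
  shows "ell2_hyponormal T"
proof -
  have S': "ell2_bounded_op S"
    and adj: "\<And>f g. f \<in> ell2 \<Longrightarrow> g \<in> ell2 \<Longrightarrow> ell2_inner (T f) g = ell2_inner f (S g)"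
    using S by (auto simp: ell2_adjoint_of_def)
  have "ell2_inner (\<lambda>n. S (T f) n - T (S f) n) f \<in> \<real>\<^sub>\<ge>\<^sub>0" if f: "f \<in> ell2" for f
  proof -
    have Tf: "T f \<in> ell2" and Sf: "S f \<in> ell2"
      using T S' f by (auto simp: ell2_bounded_op_def)
    hence STf: "S (T f) \<in> ell2" and TSf: "T (S f) \<in> ell2"
      using T S' by (auto simp: ell2_bounded_op_def)
    have "ell2_inner (\<lambda>n. S (T f) n - T (S f) n) f = ell2_inner (S (T f)) f - ell2_inner (T (S f)) f"
      using suminf_diff[OF summable_ell2_inner[OF STf f] summable_ell2_inner[OF TSf f]]
      by (simp add: ell2_inner_def algebra_simps)
    also have "ell2_inner (S (T f)) f = cnj (ell2_inner (T f) (T f))"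
      using cnj_ell2_inner[OF f STf] adj[OF f Tf] by simp
    also have "ell2_inner (T (S f)) f = ell2_inner (S f) (S f)"
      using adj[OF Sf f] .
    finally have eq: "ell2_inner (\<lambda>n. S (T f) n - T (S f) n) f
        = complex_of_real ((ell2_norm (T f))\<^sup>2 - (ell2_norm (S f))\<^sup>2)"
      by (simp add: ell2_inner_self Tf Sf)
    show ?thesis
      unfolding eq nonneg_Reals_of_real_iff
      using le[OF f] ell2_norm_nonneg[OF Sf] by (simp add: power_mono)
  qed
  thus ?thesis
    using T S by (auto simp: ell2_hyponormal_def)
qed

section \<open>Negligible boundary terms\<close>

text \<open>
  If the limit were positive, the summable sequence would dominate a multiple of the harmonic
  series. The boundary terms of the summations by parts below are controlled in this way, without
  any pointwise decay estimate.
\<close>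

lemma limit_nonpos_of_summable_bound:
  fixes X u :: "nat \<Rightarrow> real"
  assumes X: "X \<longlonglongrightarrow> L" and u: "summable u" and bound: "\<And>n. X n \<le> C * (real n + 1) * u n"
    and C: "C > 0"
  shows "L \<le> 0"
proof (rule ccontr)
  assume "\<not> L \<le> 0"
  hence L: "L > 0" by simp
  have "\<forall>\<^sub>F n in sequentially. L / 2 < X n"
    by (rule order_tendstoD(1)[OF X]) (use L in simp)
  hence ev: "\<forall>\<^sub>F n in sequentially. norm (inverse (real (Suc n))) \<le> 2 * C / L * u n"
  proof eventually_elim
    case (elim n)
    hence "L / 2 < C * (real n + 1) * u n" using bound[of n] by linarith
    hence "L \<le> (2 * C * u n) * (real n + 1)" by (simp add: algebra_simps)
    hence "1 / (real n + 1) \<le> 2 * C * u n / L"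
      using L by (simp add: divide_le_eq le_divide_eq mult.commute)
    thus ?case by (simp add: inverse_eq_divide add.commute)
  qed
  have "summable (\<lambda>n. inverse (real (Suc n)))"
    by (rule summable_comparison_test_ev[OF ev]) (rule summable_mult[OF u])
  hence "summable (\<lambda>n. inverse (real n))"
    using summable_Suc_iff[where f = "\<lambda>n. inverse (real n)"] by blast
  thus False
    using not_summable_harmonic[where ?'a = real] by blast
qed

section \<open>Terraced matrices with weights of order \<open>1 / n\<close>\<close>

definition terraced_adjoint :: "(nat \<Rightarrow> complex) \<Rightarrow> (nat \<Rightarrow> complex) \<Rightarrow> nat \<Rightarrow> complex" where
  "terraced_adjoint a f j = (\<Sum>n. cnj (a (n + j)) * f (n + j))"

locale terraced_weights =
  fixes a :: "nat \<Rightarrow> complex" and K :: real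
  assumes weight_le: "cmod (a n) \<le> K / real (Suc n)"
begin

lemma K_nonneg: "0 \<le> K"
  using order_trans[OF norm_ge_zero weight_le[of 0]] by simp

lemma weight_mult_le: "cmod (a n) * cmod z \<le> K * (cmod z / real (Suc n))"
  using mult_right_mono[OF weight_le, of "cmod z"] by simp

lemma terraced_ell2:
  assumes "f \<in> ell2"
  shows "matrix_op (terraced_matrix a) f \<in> ell2"
    and "ell2_norm (matrix_op (terraced_matrix a) f) \<le> 2 * K * ell2_norm f"
proof -
  have "(\<Sum>n<N. (cmod (matrix_op (terraced_matrix a) f n))\<^sup>2) \<le> (2 * K * ell2_norm f)\<^sup>2" for N
  proof -
    have "cmod (matrix_op (terraced_matrix a) f n) \<le> K * ((\<Sum>j\<le>n. cmod (f j)) / real (Suc n))" for n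
    proof -
      have "cmod (matrix_op (terraced_matrix a) f n) \<le> K * (cmod (\<Sum>j\<le>n. f j) / real (Suc n))"
        unfolding matrix_op_terraced norm_mult by (rule weight_mult_le)
      also have "\<dots> \<le> K * ((\<Sum>j\<le>n. cmod (f j)) / real (Suc n))"
        by (intro mult_left_mono divide_right_mono norm_sum K_nonneg) simp
      finally show ?thesis .
    qed
    hence "(\<Sum>n<N. (cmod (matrix_op (terraced_matrix a) f n))\<^sup>2)
        \<le> (\<Sum>n<N. (K * ((\<Sum>j\<le>n. cmod (f j)) / real (Suc n)))\<^sup>2)"
      by (intro sum_mono power_mono) auto
    also have "\<dots> = K\<^sup>2 * (\<Sum>n<N. ((\<Sum>j\<le>n. cmod (f j)) / real (Suc n))\<^sup>2)"
      by (simp only: power_mult_distrib sum_distrib_left)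
    also have "\<dots> \<le> K\<^sup>2 * (4 * (ell2_norm f)\<^sup>2)"
      using hardy_inequality[where x = "\<lambda>n. cmod (f n)" and N = N]
        sum_cmod_squared_le_ell2_norm[OF assms, of N]
      by (intro mult_left_mono) auto
    finally show ?thesis by (simp add: power_mult_distrib)
  qed
  moreover have "0 \<le> 2 * K * ell2_norm f"
    using K_nonneg ell2_norm_nonneg[OF assms] by simp
  ultimately show "matrix_op (terraced_matrix a) f \<in> ell2"
    and "ell2_norm (matrix_op (terraced_matrix a) f) \<le> 2 * K * ell2_norm f"
    by (rule ell2_of_bounded_partial_sums)+
qed

lemma bounded_op_terraced: "ell2_bounded_op (matrix_op (terraced_matrix a))"
  unfolding ell2_bounded_op_def
proof (intro conjI ballI allI exI)
  fix f g :: "nat \<Rightarrow> complex" and c :: complex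
  show "matrix_op (terraced_matrix a) (\<lambda>n. f n + g n)
      = (\<lambda>n. matrix_op (terraced_matrix a) f n + matrix_op (terraced_matrix a) g n)"
    by (simp add: fun_eq_iff matrix_op_terraced sum.distrib distrib_left)
  show "matrix_op (terraced_matrix a) (\<lambda>n. c * f n) = (\<lambda>n. c * matrix_op (terraced_matrix a) f n)"
    by (simp add: fun_eq_iff matrix_op_terraced sum_distrib_left mult.left_commute)
qed (rule terraced_ell2; assumption)+

lemma weights_ell2: "a \<in> ell2"
proof -
  have "summable (\<lambda>n. K\<^sup>2 * inverse (real (Suc n) ^ 2))"
    using inverse_squares_sums by (intro summable_mult) (simp add: sums_iff inverse_eq_divide)
  moreover have "norm ((cmod (a n))\<^sup>2) \<le> K\<^sup>2 * inverse (real (Suc n) ^ 2)" for n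
    using power_mono[OF weight_le norm_ge_zero, of n 2]
    by (simp add: power_divide inverse_eq_divide)
  ultimately have "summable (\<lambda>n. (cmod (a n))\<^sup>2)"
    by (rule summable_comparison_test'[where N = 0])
  thus ?thesis by (simp add: ell2_def)
qed

lemma summable_weighted: "f \<in> ell2 \<Longrightarrow> summable (\<lambda>n. cnj (a n) * f n)"
  using summable_ell2_inner[OF _ weights_ell2] by (simp add: mult.commute)

lemma summable_weighted_shift: "f \<in> ell2 \<Longrightarrow> summable (\<lambda>n. cnj (a (n + j)) * f (n + j))"
  using summable_weighted summable_iff_shift[where f = "\<lambda>n. cnj (a n) * f n"] by blast

lemma terraced_adjoint_rec:
  assumes "f \<in> ell2"
  shows "terraced_adjoint a f j = cnj (a j) * f j + terraced_adjoint a f (Suc j)"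
  using suminf_split_head[OF summable_weighted_shift[OF assms, of j]]
  by (simp add: terraced_adjoint_def)

lemma terraced_adjoint_ell2:
  assumes "f \<in> ell2"
  shows "terraced_adjoint a f \<in> ell2" "ell2_norm (terraced_adjoint a f) \<le> 2 * K * ell2_norm f"
proof -
  \<comment> \<open>The finite dual Hardy inequality bounds the tails cut off at \<open>N\<close>; then \<open>N\<close> tends to infinity.\<close>
  define t where "t N j = (\<Sum>n=j..<N. cnj (a n) * f n)" for N j
  have bound: "(\<Sum>j<J. (cmod (t N j))\<^sup>2) \<le> (2 * K * ell2_norm f)\<^sup>2" if "J \<le> N" for J N
  proof -
    have "(\<Sum>j<J. (cmod (t N j))\<^sup>2) \<le> (\<Sum>j<N. (cmod (t N j))\<^sup>2)"
      using that by (intro sum_mono2) auto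
    also have "\<dots> \<le> (\<Sum>j<N. (K * (\<Sum>n=j..<N. cmod (f n) / real (Suc n)))\<^sup>2)"
    proof (intro sum_mono power_mono)
      fix j
      show "cmod (t N j) \<le> K * (\<Sum>n=j..<N. cmod (f n) / real (Suc n))"
        unfolding t_def sum_distrib_left
        by (rule sum_norm_le) (simp only: norm_mult complex_mod_cnj weight_mult_le)
    qed simp
    also have "\<dots> = K\<^sup>2 * (\<Sum>j<N. (\<Sum>n=j..<N. cmod (f n) / real (Suc n))\<^sup>2)"
      by (simp only: power_mult_distrib sum_distrib_left[symmetric])
    also have "\<dots> \<le> K\<^sup>2 * (4 * (ell2_norm f)\<^sup>2)"
      using dual_hardy_inequality[where x = "\<lambda>n. cmod (f n)" and N = N]
        sum_cmod_squared_le_ell2_norm[OF assms, of N]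
      by (intro mult_left_mono) auto
    finally show ?thesis by (simp add: power_mult_distrib)
  qed
  have lim: "(\<lambda>N. t N j) \<longlonglongrightarrow> terraced_adjoint a f j" for j
  proof -
    have "(\<lambda>n. \<Sum>i<n. cnj (a (i + j)) * f (i + j)) \<longlonglongrightarrow> terraced_adjoint a f j"
      unfolding terraced_adjoint_def
      using summable_weighted_shift[OF assms] by (rule summable_LIMSEQ)
    moreover have "(\<Sum>i<n. cnj (a (i + j)) * f (i + j)) = t (n + j) j" for n
      using sum.shift_bounds_nat_ivl[of "\<lambda>n. cnj (a n) * f n" 0 j n]
      by (simp add: t_def atLeast0LessThan)
    ultimately show ?thesis
      by (simp add: LIMSEQ_offset[where k = j])
  qed
  have "(\<Sum>j<J. (cmod (terraced_adjoint a f j))\<^sup>2) \<le> (2 * K * ell2_norm f)\<^sup>2" for J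
  proof (rule LIMSEQ_le_const2)
    show "(\<lambda>N. \<Sum>j<J. (cmod (t N j))\<^sup>2) \<longlonglongrightarrow> (\<Sum>j<J. (cmod (terraced_adjoint a f j))\<^sup>2)"
      by (intro tendsto_intros lim)
    show "\<exists>N. \<forall>n\<ge>N. (\<Sum>j<J. (cmod (t n j))\<^sup>2) \<le> (2 * K * ell2_norm f)\<^sup>2"
      using bound by blast
  qed
  moreover have "0 \<le> 2 * K * ell2_norm f"
    using K_nonneg ell2_norm_nonneg[OF assms] by simp
  ultimately show "terraced_adjoint a f \<in> ell2"
    and "ell2_norm (terraced_adjoint a f) \<le> 2 * K * ell2_norm f"
    by (rule ell2_of_bounded_partial_sums)+
qed

lemma bounded_op_terraced_adjoint: "ell2_bounded_op (terraced_adjoint a)"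
  unfolding ell2_bounded_op_def
proof (intro conjI ballI allI exI)
  fix f g :: "nat \<Rightarrow> complex" and c :: complex
  assume f: "f \<in> ell2"
  show "terraced_adjoint a (\<lambda>n. c * f n) = (\<lambda>n. c * terraced_adjoint a f n)"
    using suminf_mult[OF summable_weighted_shift[OF f], of c]
    by (simp add: fun_eq_iff terraced_adjoint_def mult.left_commute)
  assume g: "g \<in> ell2"
  show "terraced_adjoint a (\<lambda>n. f n + g n) = (\<lambda>n. terraced_adjoint a f n + terraced_adjoint a g n)"
    using suminf_add[OF summable_weighted_shift[OF f] summable_weighted_shift[OF g]]
    by (simp add: fun_eq_iff terraced_adjoint_def distrib_left)
qed (rule terraced_adjoint_ell2; assumption)+

text \<open>
  Summation by parts: the partial sums of the two inner products differ by the boundary term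
  \<open>S N * cnj (T (N + 1))\<close>, where \<open>S\<close> denotes the partial sums of \<open>f\<close> and \<open>T\<close> the tails that form
  the image of \<open>g\<close>. Since \<open>S N\<close> is the \<open>N\<close>-th entry of the image of \<open>f\<close> divided by \<open>a N\<close>, the
  boundary term is at most a multiple of \<open>N\<close> times a term of a summable sequence as soon as \<open>1 / a N\<close> grows at most
  linearly.
\<close>

lemma terraced_adjoint_of:
  assumes weight_ge: "\<And>n. 1 \<le> C * (real n + 1) * cmod (a n)" and C: "C > 0"
  shows "ell2_adjoint_of (matrix_op (terraced_matrix a)) (terraced_adjoint a)"
  unfolding ell2_adjoint_of_def
proof (intro conjI ballI bounded_op_terraced_adjoint)
  fix f g
  assume f: "f \<in> ell2" and g: "g \<in> ell2"
  define G where "G = matrix_op (terraced_matrix a) f"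
  define T where "T = terraced_adjoint a g"
  define S where "S n = (\<Sum>j\<le>n. f j)" for n
  have G: "G n = a n * S n" for n
    by (simp add: G_def S_def matrix_op_terraced)
  have G2: "G \<in> ell2" and T2: "T \<in> ell2"
    using terraced_ell2 terraced_adjoint_ell2 f g by (auto simp: G_def T_def)
  have T: "T j = cnj (a j) * g j + T (Suc j)" for j
    unfolding T_def by (rule terraced_adjoint_rec[OF g])
  have parts: "(\<Sum>n<Suc N. f n * cnj (T n)) - (\<Sum>n<Suc N. G n * cnj (g n)) = S N * cnj (T (Suc N))"
    for N
  proof (induction N)
    case 0
    show ?case using T[of 0] by (simp add: G S_def algebra_simps)
  next
    case (Suc N)
    have "S (Suc N) = S N + f (Suc N)" by (simp add: S_def)
    thus ?case using Suc T[of "Suc N"] by (simp add: G algebra_simps)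
  qed
  have lim: "(\<lambda>N. cmod (S N * cnj (T (Suc N)))) \<longlonglongrightarrow> cmod (ell2_inner f T - ell2_inner G g)"
    unfolding parts[symmetric] ell2_inner_def
    by (intro tendsto_norm tendsto_diff LIMSEQ_Suc[OF summable_LIMSEQ] summable_ell2_inner f T2 G2 g)
  have "summable (\<lambda>n. cmod (T (Suc n)) * cmod (G n))"
  proof (rule summable_cmod_mult_ell2)
    show "(\<lambda>n. T (Suc n)) \<in> ell2"
      using T2 by (simp add: ell2_def summable_Suc_iff[where f = "\<lambda>n. (cmod (T n))\<^sup>2"])
  qed (rule G2)
  moreover have "cmod (S n * cnj (T (Suc n))) \<le> C * (real n + 1) * (cmod (T (Suc n)) * cmod (G n))"
    for n
    using mult_right_mono[OF weight_ge[of n], of "cmod (S n) * cmod (T (Suc n))"]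
    by (simp add: G norm_mult algebra_simps)
  ultimately have "cmod (ell2_inner f T - ell2_inner G g) \<le> 0"
    using limit_nonpos_of_summable_bound[OF lim] C by blast
  thus "ell2_inner (matrix_op (terraced_matrix a) f) g = ell2_inner f (terraced_adjoint a g)"
    by (simp add: G_def T_def)
qed

end

section \<open>Reciprocals of concave sequences\<close>

text \<open>
  One step of the elimination of the mixed term: with \<open>E = D - g / c\<close> for the next value of \<open>D\<close>,
  the right-hand side minus the left-hand side is \<open>(c - c' - 1) * \<bar>D\<bar>\<^sup>2 + \<bar>g\<bar>\<^sup>2 / c\<close>.
\<close>

lemma cmod_diff_squared_le:
  fixes D g :: complex and c c' :: real
  assumes "c > 0" "c' + 1 \<le> c"
  shows "(cmod (D - g))\<^sup>2 \<le> (cmod g)\<^sup>2 + c * (cmod (D - g / complex_of_real c))\<^sup>2 - c' * (cmod D)\<^sup>2"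
proof -
  have "(cmod g)\<^sup>2 + c * (cmod (D - g / complex_of_real c))\<^sup>2 - c' * (cmod D)\<^sup>2 - (cmod (D - g))\<^sup>2
      = (c - c' - 1) * (cmod D)\<^sup>2 + (cmod g)\<^sup>2 / c"
    using assms(1) unfolding cmod_power2 by (simp add: field_simps power2_eq_square)
  also have "\<dots> \<ge> 0"
    using assms by simp
  finally show ?thesis by simp
qed

text \<open>
  The number \<open>\<kappa>\<close> makes \<open>b\<close> grow at least linearly, as boundedness of the operator requires, and
  keeps the coefficients \<open>c n = b (n + 1) / (b (n + 1) - b n)\<close> of linear order, as the boundary term
  requires. The last hypothesis is concavity at the left end when the sequence is extended by the
  value 0 at \<open>-1\<close>; it amounts to \<open>c 0 \<ge> 2\<close>.
\<close>

theorem terraced_hyponormal_of_concave_reciprocal: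
  fixes b :: "nat \<Rightarrow> real"
  assumes \<kappa>: "0 < \<kappa>" and incr: "\<And>n. \<kappa> \<le> b (Suc n) - b n"
    and concave: "\<And>n. b (Suc (Suc n)) - b (Suc n) \<le> b (Suc n) - b n"
    and left: "b 1 - b 0 \<le> b 0"
  shows "ell2_hyponormal (matrix_op (terraced_matrix (\<lambda>n. complex_of_real (1 / b n))))"
proof -
  define a where "a n = complex_of_real (1 / b n)" for n
  define \<delta> where "\<delta> n = b (Suc n) - b n" for n
  have \<delta>_pos: "\<delta> n > 0" for n
    using incr[of n] \<kappa> by (simp add: \<delta>_def)
  have \<delta>_le: "\<delta> n \<le> b 0" for n
    using decseq_SucI[of \<delta>] concave left decseqD[of \<delta> 0 n] by (force simp: \<delta>_def)
  have lower: "\<kappa> * (real n + 1) \<le> b n" for n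
  proof (induction n)
    case 0
    show ?case using incr[of 0] left by simp
  next
    case (Suc n)
    thus ?case using incr[of n] by (simp add: algebra_simps)
  qed
  have upper: "b n \<le> b 0 * (real n + 1)" for n
  proof (induction n)
    case 0
    show ?case by simp
  next
    case (Suc n)
    thus ?case using \<delta>_le[of n] by (simp add: \<delta>_def algebra_simps)
  qed
  have b_pos: "b n > 0" for n
  proof -
    have "0 < \<kappa> * (real n + 1)" using \<kappa> by simp
    thus ?thesis using lower[of n] by linarith
  qed
  interpret terraced_weights a "1 / \<kappa>"
  proof
    fix n
    have "1 / b n \<le> 1 / (\<kappa> * (real n + 1))"
      using lower[of n] b_pos[of n] \<kappa> by (intro divide_left_mono) auto
    thus "cmod (a n) \<le> 1 / \<kappa> / real (Suc n)"
      using b_pos[of n] by (simp add: a_def norm_divide add.commute)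
  qed
  have adjoint: "ell2_adjoint_of (matrix_op (terraced_matrix a)) (terraced_adjoint a)"
  proof (rule terraced_adjoint_of)
    show "1 \<le> b 0 * (real n + 1) * cmod (a n)" for n
      using upper[of n] b_pos[of n] by (simp add: a_def norm_divide field_simps)
  qed (rule b_pos)

  define c where "c n = b (Suc n) / \<delta> n" for n
  have c_pos: "c n > 0" for n
    using b_pos \<delta>_pos by (simp add: c_def)
  have c0: "2 \<le> c 0"
    using \<delta>_pos[of 0] left by (simp add: c_def \<delta>_def pos_le_divide_eq)
  have c_Suc: "c n + 1 \<le> c (Suc n)" for n
  proof -
    have "c n + 1 = (b (Suc n) + \<delta> n) / \<delta> n"
      using \<delta>_pos[of n] by (simp add: c_def add_divide_distrib)
    also have "\<dots> = 1 + b (Suc n) / \<delta> n"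
      using \<delta>_pos[of n] by (simp add: add_divide_distrib)
    also have "\<dots> \<le> 1 + b (Suc n) / \<delta> (Suc n)"
      using concave[of n] \<delta>_pos[of n] \<delta>_pos[of "Suc n"] b_pos[of "Suc n"]
      by (intro add_left_mono divide_left_mono) (auto simp: \<delta>_def)
    also have "\<dots> = c (Suc n)"
      using \<delta>_pos[of "Suc n"] by (simp add: c_def \<delta>_def field_simps)
    finally show ?thesis .
  qed
  have c_le: "c n \<le> 2 * b 0 / \<kappa> * (real n + 1)" for n
  proof -
    have "c n \<le> b (Suc n) / \<kappa>"
      using incr[of n] \<kappa> b_pos[of "Suc n"] unfolding c_def \<delta>_def
      by (intro divide_left_mono) auto
    also have "\<dots> \<le> (2 * b 0 * (real n + 1)) / \<kappa>"
    proof (intro divide_right_mono)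
      have "b 0 * real n \<ge> 0" using b_pos[of 0] by simp
      thus "b (Suc n) \<le> 2 * b 0 * (real n + 1)"
        using upper[of "Suc n"] by (simp add: algebra_simps)
    qed (use \<kappa> in simp)
    finally show ?thesis by simp
  qed

  have "ell2_norm (terraced_adjoint a f) \<le> ell2_norm (matrix_op (terraced_matrix a) f)"
    if f: "f \<in> ell2" for f
  proof -
    define g where "g = matrix_op (terraced_matrix a) f"
    define T where "T = terraced_adjoint a f"
    define D where "D j = T (Suc j) + g j" for j
    have g2: "g \<in> ell2" and T2: "T \<in> ell2"
      using terraced_ell2 terraced_adjoint_ell2 f by (auto simp: g_def T_def)
    have T: "T j = a j * f j + T (Suc j)" for j
      using terraced_adjoint_rec[OF f, of j] by (simp add: T_def a_def)
    have D0: "D 0 = T 0"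
      using T[of 0] by (simp add: D_def g_def matrix_op_terraced)
    have D_Suc: "D (Suc j) = D j - g j / complex_of_real (c j)" for j
    proof -
      define s where "s = (\<Sum>i\<le>j. f i)"
      have "g j = a j * s" "g (Suc j) = a (Suc j) * (s + f (Suc j))"
        by (simp_all add: g_def s_def matrix_op_terraced)
      hence "D j - D (Suc j) = (a j - a (Suc j)) * s"
        using T[of "Suc j"] by (simp add: D_def algebra_simps)
      also have "a j - a (Suc j) = a j / complex_of_real (c j)"
      proof -
        have "1 / b j - 1 / b (Suc j) = (1 / b j) / c j"
          using b_pos[of j] b_pos[of "Suc j"] \<delta>_pos[of j]
          by (simp add: c_def \<delta>_def field_simps)
        thus ?thesis
          unfolding a_def by (metis of_real_diff of_real_divide)
      qed
      finally show ?thesis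
        using \<open>g j = a j * s\<close> by (simp add: algebra_simps)
    qed
    have step: "(cmod (T (Suc j)))\<^sup>2 \<le> (cmod (g j))\<^sup>2 + c j * (cmod (D (Suc j)))\<^sup>2 - r * (cmod (D j))\<^sup>2"
      if "r + 1 \<le> c j" for j r
      using cmod_diff_squared_le[OF c_pos that, of "D j" "g j"] D_Suc[of j] by (simp add: D_def)
    have partial: "(\<Sum>j<Suc (Suc N). (cmod (T j))\<^sup>2)
        \<le> (\<Sum>j<Suc N. (cmod (g j))\<^sup>2) + c N * (cmod (D (Suc N)))\<^sup>2" for N
    proof (induction N)
      case 0
      \<comment> \<open>The coefficient \<open>r = 1\<close> absorbs the extra term \<open>T 0 = D 0\<close>.\<close>
      show ?case using step[of 1 0] c0 D0 by simp
    next
      case (Suc N)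
      show ?case using step[OF c_Suc[of N]] Suc by simp
    qed
    define X where
      "X N = (\<Sum>j<Suc (Suc N). (cmod (T j))\<^sup>2) - (\<Sum>j<Suc N. (cmod (g j))\<^sup>2)" for N
    define u where "u n = (cmod (T (Suc (Suc n))))\<^sup>2 + (cmod (g (Suc n)))\<^sup>2" for n
    have sT: "summable (\<lambda>n. (cmod (T n))\<^sup>2)" and sg: "summable (\<lambda>n. (cmod (g n))\<^sup>2)"
      using T2 g2 by (auto simp: ell2_def)
    have "X \<longlonglongrightarrow> (\<Sum>n. (cmod (T n))\<^sup>2) - (\<Sum>n. (cmod (g n))\<^sup>2)"
      unfolding X_def
      by (intro tendsto_diff LIMSEQ_Suc[OF LIMSEQ_Suc[OF summable_LIMSEQ[OF sT]]]
          LIMSEQ_Suc[OF summable_LIMSEQ[OF sg]])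
    hence lim: "X \<longlonglongrightarrow> (ell2_norm T)\<^sup>2 - (ell2_norm g)\<^sup>2"
      using T2 g2 by (simp add: ell2_norm_squared)
    have "summable u"
      unfolding u_def
      using summable_ignore_initial_segment[OF sT, of 2] summable_ignore_initial_segment[OF sg, of 1]
      by (intro summable_add) simp_all
    moreover have "X n \<le> 4 * b 0 / \<kappa> * (real n + 1) * u n" for n
    proof -
      have "X n \<le> c n * (cmod (D (Suc n)))\<^sup>2"
        using partial[of n] by (simp add: X_def)
      also have "\<dots> \<le> (2 * b 0 / \<kappa> * (real n + 1)) * (2 * u n)"
      proof (rule mult_mono[OF c_le])
        have "(cmod (D (Suc n)))\<^sup>2 \<le> (cmod (T (Suc (Suc n))) + cmod (g (Suc n)))\<^sup>2"
          unfolding D_def by (intro power_mono norm_triangle_ineq) simp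
        also have "\<dots> \<le> 2 * u n"
          using sum_squares_bound[of "cmod (T (Suc (Suc n)))" "cmod (g (Suc n))"]
          by (simp add: u_def power2_sum)
        finally show "(cmod (D (Suc n)))\<^sup>2 \<le> 2 * u n" .
      qed (use \<kappa> b_pos[of 0] in auto)
      finally show ?thesis by (simp add: algebra_simps)
    qed
    moreover have "4 * b 0 / \<kappa> > 0"
      using \<kappa> b_pos[of 0] by simp
    ultimately have "(ell2_norm T)\<^sup>2 - (ell2_norm g)\<^sup>2 \<le> 0"
      using limit_nonpos_of_summable_bound[OF lim] by blast
    hence "ell2_norm T \<le> ell2_norm g"
      using power2_le_imp_le[OF _ ell2_norm_nonneg[OF g2]] by simp
    thus ?thesis by (simp add: T_def g_def)
  qed
  hence "ell2_hyponormal (matrix_op (terraced_matrix a))"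
    by (rule ell2_hyponormalI[OF bounded_op_terraced adjoint])
  thus ?thesis
    unfolding a_def .
qed

section \<open>Concavity of \<open>cot (1 / x)\<close>\<close>

text \<open>Monotonicity of \<open>sin y / y\<close> makes the derivative \<open>1 / (x * sin (1 / x))\<^sup>2\<close> decreasing.\<close>

lemma sin_over_arg_antimono:
  fixes y z :: real
  assumes "0 < y" "y \<le> z" "z < pi / 2"
  shows "sin z / z \<le> sin y / y"
proof (rule DERIV_nonpos_imp_nonincreasing[OF assms(2)])
  fix x
  assume "y \<le> x" "x \<le> z"
  hence x: "0 < x" "x < pi / 2" using assms by auto
  have "x \<le> tan x"
    using abs_tan_ge[of x] tan_gt_zero[of x] x by simp
  hence "x * cos x \<le> sin x"
    using cos_gt_zero[of x] x by (simp add: tan_def field_simps)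
  hence "(cos x * x - sin x) / x\<^sup>2 \<le> 0"
    using x by (simp add: divide_nonpos_pos mult.commute)
  moreover have "((\<lambda>x. sin x / x) has_real_derivative (cos x * x - sin x) / x\<^sup>2) (at x)"
    using x by (auto intro!: derivative_eq_intros simp: power2_eq_square)
  ultimately show "\<exists>d. ((\<lambda>x. sin x / x) has_real_derivative d) (at x) \<and> d \<le> 0"
    by blast
qed

lemma cot_reciprocal_has_derivative:
  fixes x :: real
  assumes "1 \<le> x"
  shows "((\<lambda>x. cot (1 / x)) has_real_derivative 1 / (x * sin (1 / x))\<^sup>2) (at x)"
proof -
  have "sin (1 / x) > 0"
    using assms by (intro sin_gt_zero_02) (auto simp: field_simps)
  moreover have "((\<lambda>x. 1 / x) has_real_derivative - (1 / x\<^sup>2)) (at x)"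
    using assms by (auto intro!: derivative_eq_intros simp: power2_eq_square)
  ultimately have "((\<lambda>x. cot (1 / x)) has_real_derivative
      - inverse ((sin (1 / x))\<^sup>2) * - (1 / x\<^sup>2)) (at x)"
    by (intro DERIV_chain2[OF DERIV_cot]) auto
  thus ?thesis
    by (simp add: power_mult_distrib inverse_eq_divide mult.commute)
qed

lemma cot_reciprocal_increment:
  fixes x :: real
  assumes "1 \<le> x"
  obtains z where "x < z" "z < x + 1" "cot (1 / (x + 1)) - cot (1 / x) = 1 / (z * sin (1 / z))\<^sup>2"
proof -
  have "\<exists>z. x < z \<and> z < x + 1 \<and>
      cot (1 / (x + 1)) - cot (1 / x) = (x + 1 - x) * (1 / (z * sin (1 / z))\<^sup>2)"
    using assms by (intro MVT2 cot_reciprocal_has_derivative) auto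
  thus ?thesis using that by auto
qed

lemma arg_mult_sin_reciprocal_pos:
  fixes x :: real
  assumes "1 \<le> x"
  shows "0 < x * sin (1 / x)"
  using assms by (intro mult_pos_pos sin_gt_zero_02) (auto simp: field_simps)

lemma cot_reciprocal_increment_ge_1:
  fixes x :: real
  assumes "1 \<le> x"
  shows "1 \<le> cot (1 / (x + 1)) - cot (1 / x)"
proof -
  obtain z where z: "x < z" "cot (1 / (x + 1)) - cot (1 / x) = 1 / (z * sin (1 / z))\<^sup>2"
    using cot_reciprocal_increment[OF assms] by metis
  have "0 < z * sin (1 / z)"
    using z assms by (intro arg_mult_sin_reciprocal_pos) auto
  moreover have "z * sin (1 / z) \<le> 1"
    using sin_x_le_x[of "1 / z"] z assms by (simp add: field_simps)
  ultimately have "1 / 1 \<le> 1 / (z * sin (1 / z))\<^sup>2"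
    by (intro frac_le power_le_one zero_less_power) auto
  thus ?thesis
    unfolding z(2) by simp
qed

text \<open>
  Consecutive increments are values of the decreasing derivative at points \<open>z < x + 1 < w\<close>.
\<close>

lemma cot_reciprocal_increment_antimono:
  fixes x :: real
  assumes "1 \<le> x"
  shows "cot (1 / (x + 2)) - cot (1 / (x + 1)) \<le> cot (1 / (x + 1)) - cot (1 / x)"
proof -
  obtain z where z: "x < z" "z < x + 1" "cot (1 / (x + 1)) - cot (1 / x) = 1 / (z * sin (1 / z))\<^sup>2"
    using cot_reciprocal_increment[OF assms] by metis
  obtain w where w: "x + 1 < w"
    "cot (1 / (x + 1 + 1)) - cot (1 / (x + 1)) = 1 / (w * sin (1 / w))\<^sup>2"
    using cot_reciprocal_increment[of "x + 1"] assms by (metis add_increasing2 zero_le_one)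
  have "1 / z < pi / 2"
    using z(1) assms pi_gt3 by (simp add: field_simps) (smt (verit) mult_less_cancel_left2)
  moreover have "0 < 1 / w" "1 / w \<le> 1 / z"
    using z w assms by (auto intro: divide_left_mono)
  ultimately have "sin (1 / z) / (1 / z) \<le> sin (1 / w) / (1 / w)"
    by (intro sin_over_arg_antimono)
  hence le: "z * sin (1 / z) \<le> w * sin (1 / w)"
    by (simp add: mult.commute)
  have "0 < z * sin (1 / z)"
    using z assms by (intro arg_mult_sin_reciprocal_pos) auto
  hence "1 / (w * sin (1 / w))\<^sup>2 \<le> 1 / (z * sin (1 / z))\<^sup>2"
    using le by (intro frac_le power_mono zero_less_power) auto
  thus ?thesis
    unfolding z(3) using w(2) by (simp add: add.commute)
qed

section \<open>The terraced matrix of \<open>tan (1 / (n + 2))\<close>\<close>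

theorem proposition3:
  fixes a :: "nat \<Rightarrow> complex"
  assumes "\<And>n. a n = complex_of_real (tan (1 / (real n + 2)))"
  shows "ell2_hyponormal (matrix_op (terraced_matrix a))"
proof -
  define b where "b n = cot (1 / (real n + 2))" for n
  have "ell2_hyponormal (matrix_op (terraced_matrix (\<lambda>n. complex_of_real (1 / b n))))"
  proof (rule terraced_hyponormal_of_concave_reciprocal)
    show "1 \<le> b (Suc n) - b n" for n
      using cot_reciprocal_increment_ge_1[of "real n + 2"] by (simp add: b_def add.commute)
    show "b (Suc (Suc n)) - b (Suc n) \<le> b (Suc n) - b n" for n
      using cot_reciprocal_increment_antimono[of "real n + 2"] by (simp add: b_def algebra_simps)
    have "0 < cot (1 :: real)"
      using pi_gt3 by (intro cot_gt_zero) auto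
    thus "b 1 - b 0 \<le> b 0"
      using cot_reciprocal_increment_antimono[of 1] by (simp add: b_def)
  qed simp
  moreover have "a = (\<lambda>n. complex_of_real (1 / b n))"
    using assms by (simp add: fun_eq_iff b_def tan_altdef inverse_eq_divide)
  ultimately show ?thesis by simp
qed

end
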